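(* Let $k\ge 1$ and write $k=2q_k+r_k$ with integers $q_k\ge 0$ and $r_k\in\{0,1\}$. Let $\delta_k=\lceil k/2\rceil$ and define the integer sequence $g_{3,k}:\mathbb{Z}_{\ge 0}\to\mathbb{Z}_{\ge 0}$ by $$g_{3,k}(n)=\bigl|\mathrm{Crit}_{n+\delta_k,3,k,n+\delta_k}\bigr| .$$ Then the generating functions satisfy $$\mathrm{GF}(g_{3,k})=\bigl(\mathrm{GF}(M)\bigr)^{q_k}\cdot\bigl(\mathrm{GF}(R)\bigr)^{r_k},$$ where $M$ and $R$ denote the sequences of Motzkin numbers and of Riordan numbers, respectively.
   Context: For a sequence $S:\mathbb{Z}_{\ge 0}\to\mathbb{Z}_{\ge 0}$, $\mathrm{GF}(S)=\sum_{n\ge 0}S(n)y^n$. A Motzkin path of length $n$ is a lattice path from $(0,0)$ to $(n,0)$ with steps $(1,1)$ (up), $(1,0)$ (flat), $(1,-1)$ (down) that never falls below the $x$-axis. $M(n)$ is the number of Motzkin paths of length $n$ ($M(0)=1$). $R(n)$ is the number of Motzkin paths of length $n$ without flat steps on the $x$-axis ($R(0)=1$, $R(1)=0$). Sets $\mathrm{Crit}$: let $N\ge 1$, $k\geq 1$, and $\mathbf{m}=(m_1,\dots,m_N)\in\mathbb{Z}_{\ge2}^N$. A monomial $s=x_1^{s_1}\cdots x_N^{s_N}$ is $\mathbf{m}$-free if $s_i<m_i$ for all $i$; put $s_{\le j}=x_1^{s_1}\cdots x_j^{s_j}$. For $1\le j\le N$, $$\overline{\mathrm{Crit}}_{N,\mathbf{m},k,j}=\Bigl\{s\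 \Big|\ s\text{ is an }\mathbf{m}\text{-free monomial in }x_1,\dots,x_N,\ x_j\mid s,\ s_j=2\deg(s_{\le j})-k-\sum_{i=1}^{j-1}m_i+(j-1)\Bigr\},$$ and $\mathrm{Crit}_{N,\mathbf{m},k,j}$ is the set of monomials $s\in\overline{\mathrm{Crit}}_{N,\mathbf{m},k,j}$ involving only $x_1,\dots,x_j$ that are not divisible by any element of $\overline{\mathrm{Crit}}_{N,\mathbf{m},k,\ell}$ with $1\le\ell<j$. For the constant vector $\mathbf{m}=(3,\dots,3)$ one writes $\mathrm{Crit}_{N,3,k,j}$. *)

theory Defs
  imports Complex_Main "HOL-Library.Poly_Mapping" "HOL-Library.Product_Plus"
    "HOL-Computational_Algebra.Formal_Power_Series"
begin

text \<open>
  A monomial in the variables \<open>x\<^sub>1, x\<^sub>2, \<dots>\<close> is its finitely supported exponent function, so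
  the product of monomials is \<open>+\<close> and \<open>x\<^sub>i\<close> is \<^term>\<open>Poly_Mapping.single i 1\<close>. The ambient ring
  with \<open>N\<close> variables is expressed through \<open>monomials_in N\<close>.
\<close>

type_synonym monomial = "nat \<Rightarrow>\<^sub>0 nat"

definition monomials_in :: "nat \<Rightarrow> monomial set" where
  "monomials_in N = {s. Poly_Mapping.keys s \<subseteq> {1..N}}"

definition var :: "nat \<Rightarrow> monomial" where
  "var i = Poly_Mapping.single i 1"

definition mon_dvd :: "monomial \<Rightarrow> monomial \<Rightarrow> bool" where
  "mon_dvd s t \<longleftrightarrow> (\<exists>u. t = s + u)"

definition mon_deg :: "monomial \<Rightarrow> nat" where
  "mon_deg s = (\<Sum>i\<in>Poly_Mapping.keys s. Poly_Mapping.lookup s i)"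

definition mon_upto :: "nat \<Rightarrow> monomial \<Rightarrow> monomial" where
  "mon_upto j s = (\<Sum>i=1..j. Poly_Mapping.single i (Poly_Mapping.lookup s i))"

text \<open>
  The vector \<open>m = (m\<^sub>1, \<dots>, m\<^sub>N)\<close> is a function of which only the values on \<open>{1..N}\<close> matter.
\<close>

definition m_free :: "nat \<Rightarrow> (nat \<Rightarrow> nat) \<Rightarrow> monomial \<Rightarrow> bool" where
  "m_free N m s \<longleftrightarrow> (\<forall>i\<in>{1..N}. Poly_Mapping.lookup s i < m i)"

text \<open>
  The equation for \<open>s\<^sub>j\<close> is one between integers, as its right-hand side may be negative.
\<close>

definition Crit_bar :: "nat \<Rightarrow> (nat \<Rightarrow> nat) \<Rightarrow> nat \<Rightarrow> nat \<Rightarrow> monomial set" where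
  "Crit_bar N m k j = {s \<in> monomials_in N. m_free N m s \<and> mon_dvd (var j) s \<and>
     int (Poly_Mapping.lookup s j) =
       2 * int (mon_deg (mon_upto j s)) - int k - (\<Sum>i=1..<j. int (m i)) + (int j - 1)}"

definition Crit :: "nat \<Rightarrow> (nat \<Rightarrow> nat) \<Rightarrow> nat \<Rightarrow> nat \<Rightarrow> monomial set" where
  "Crit N m k j = {s \<in> Crit_bar N m k j. s \<in> monomials_in j \<and>
     (\<forall>l\<in>{1..<j}. \<forall>t\<in>Crit_bar N m k l. \<not> mon_dvd t s)}"

definition delta :: "nat \<Rightarrow> nat" where
  "delta k = nat \<lceil>real k / 2\<rceil>"

definition g3 :: "nat \<Rightarrow> nat \<Rightarrow> nat" where
  "g3 k n = card (Crit (n + delta k) (\<lambda>_. 3) k (n + delta k))"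

text \<open>
  A lattice path starting at \<open>(0,0)\<close> is given by its list of steps; the vertex reached after
  the first \<open>i\<close> steps is \<open>vertex w i\<close>.
\<close>

definition vertex :: "(int \<times> int) list \<Rightarrow> nat \<Rightarrow> int \<times> int" where
  "vertex w i = sum_list (take i w)"

definition motzkin_paths :: "nat \<Rightarrow> (int \<times> int) list set" where
  "motzkin_paths n = {w. set w \<subseteq> {(1, 1), (1, 0), (1, -1)} \<and>
     vertex w (length w) = (int n, 0) \<and> (\<forall>i\<le>length w. snd (vertex w i) \<ge> 0)}"

definition riordan_paths :: "nat \<Rightarrow> (int \<times> int) list set" where
  "riordan_paths n = {w \<in> motzkin_paths n.
     \<not> (\<exists>i<length w. w ! i = (1, 0) \<and> snd (vertex w i) = 0)}"

definition motzkin_number :: "nat \<Rightarrow> nat" where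
  "motzkin_number n = card (motzkin_paths n)"

definition riordan_number :: "nat \<Rightarrow> nat" where
  "riordan_number n = card (riordan_paths n)"

definition GF :: "(nat \<Rightarrow> nat) \<Rightarrow> int fps" where
  "GF S = Abs_fps (\<lambda>n. int (S n))"

end

theory Submission
  imports Defs
begin

text \<open>
  Write \<open>k = 2 p + c\<close> with \<open>c \<in> {1, 2}\<close>. The defining equation of a critical monomial says
  \<open>s\<^sub>j = c\<close> and \<open>\<Sum>i<j. (s\<^sub>i - 1) = p\<close>, so the steps \<open>1 - s\<^sub>i\<close> for \<open>i < j\<close> lead from height
  \<open>p\<close> to the axis. Not being divisible by earlier critical monomials means that this path never
  goes below the axis and, if \<open>c = 1\<close>, has no flat step on it. Cutting the path at its first
  visits to the heights \<open>p - 1, \<dots>, 0\<close> gives \<open>p\<close> Motzkin paths and then a Motzkin path (\<open>c = 2\<close>)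
  or a Riordan path (\<open>c = 1\<close>); on generating functions this follows from a linear recursion.
\<close>

unbundle fps_syntax

section \<open>Generating functions of paths descending to the axis\<close>

text \<open>Paths start at height \<open>h\<close> and end at \<open>0\<close>; the flag \<open>f\<close> permits flat steps on the axis.\<close>

definition descents :: "bool \<Rightarrow> int \<Rightarrow> nat \<Rightarrow> int list set" where
  "descents f h n = {w. length w = n \<and> set w \<subseteq> {-1, 0, 1} \<and> h + sum_list w = 0 \<and>
     (\<forall>i\<le>n. 0 \<le> h + sum_list (take i w)) \<and>
     (f \<or> (\<forall>i<n. \<not> (w ! i = 0 \<and> h + sum_list (take i w) = 0)))}"

lemma finite_descents: "finite (descents f h n)"
proof (rule finite_subset)
  show "descents f h n \<subseteq> {w. set w \<subseteq> {-1, 0, 1} \<and> length w = n}"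
    by (auto simp: descents_def)
qed (simp add: finite_lists_length_eq)

lemma descents_neg: "h < 0 \<Longrightarrow> descents f h n = {}"
  by (force simp: descents_def)

lemma descents_0: "descents f h 0 = (if h = 0 then {[]} else {})"
  by (auto simp: descents_def)

lemma all_le_Suc_split: "(\<forall>i\<le>Suc n. P i) \<longleftrightarrow> P 0 \<and> (\<forall>i\<le>n. P (Suc i))"
  by (metis Suc_le_mono le0 not0_implies_Suc)

lemma Cons_in_descents:
  assumes "h \<ge> 0"
  shows "a # w \<in> descents f h (Suc n) \<longleftrightarrow>
    a \<in> {-1, 0, 1} \<and> (f \<or> \<not> (a = 0 \<and> h = 0)) \<and> w \<in> descents f (h + a) n"
  using assms
  by (auto simp: descents_def all_le_Suc_split All_less_Suc2 add.assoc)

text \<open>Paths are sorted by their first step. For \<open>h = 0\<close> the last summand is 0,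
  since its paths would start below the axis, and the flat step is counted only if the flag permits
  it.\<close>

lemma card_descents_Suc:
  assumes "h \<ge> 0"
  shows "card (descents f h (Suc n)) = card (descents f (h + 1) n) +
    (if f \<or> h \<noteq> 0 then card (descents f h n) else 0) + card (descents f (h - 1) n)"
proof -
  let ?L = "if f \<or> h \<noteq> 0 then descents f h n else {}"
  have eq: "descents f h (Suc n) =
    ((#) 1 ` descents f (h + 1) n \<union> (#) 0 ` ?L) \<union> (#) (-1) ` descents f (h - 1) n" (is "?A = ?B")
  proof (rule set_eqI)
    fix w
    show "w \<in> ?A \<longleftrightarrow> w \<in> ?B"
    proof (cases w)
      case Nil
      then show ?thesis by (auto simp: descents_def)
    next
      case (Cons a v)
      then show ?thesis using Cons_in_descents[OF assms, of a v f n] by auto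
    qed
  qed
  have "card ?A = card ((#) 1 ` descents f (h + 1) n \<union> (#) 0 ` ?L) + card ((#) (-1) ` descents f (h - 1) n)"
    unfolding eq by (rule card_Un_disjoint) (auto simp: finite_descents)
  also have "card ((#) 1 ` descents f (h + 1) n \<union> (#) 0 ` ?L)
      = card ((#) 1 ` descents f (h + 1) n) + card ((#) (0::int) ` ?L)"
    by (rule card_Un_disjoint) (auto simp: finite_descents)
  finally show ?thesis
    by (simp add: card_image)
qed

definition descents_gf :: "bool \<Rightarrow> nat \<Rightarrow> int fps" where
  "descents_gf f h = Abs_fps (\<lambda>n. int (card (descents f (int h) n)))"

text \<open>Above the axis both flags allow every first step. There is no constant term, as the
  empty path does not descend.\<close>

lemma descents_gf_Suc:
  "descents_gf f (Suc h) =
    fps_X * (descents_gf f (Suc (Suc h)) + descents_gf f (Suc h) + descents_gf f h)"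
proof (rule fps_ext)
  fix n
  show "descents_gf f (Suc h) $ n =
    (fps_X * (descents_gf f (Suc (Suc h)) + descents_gf f (Suc h) + descents_gf f h)) $ n"
    by (cases n) (simp_all add: descents_gf_def descents_0 card_descents_Suc add.commute)
qed

lemma descents_gf_0:
  "descents_gf True 0 = 1 + fps_X * (descents_gf True 1 + descents_gf True 0)"
proof (rule fps_ext)
  fix n
  show "descents_gf True 0 $ n = (1 + fps_X * (descents_gf True 1 + descents_gf True 0)) $ n"
    by (cases n) (simp_all add: descents_gf_def descents_0 card_descents_Suc descents_neg)
qed

text \<open>The factor \<open>fps_X\<close> expresses a coefficient of index \<open>Suc n\<close>
  through those of index \<open>n\<close> at neighbouring heights, so induction on the index, for
  all heights at once, kills every coefficient.\<close>

lemma fps_recursion_unique: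
  fixes D :: "nat \<Rightarrow> 'a::comm_ring_1 fps"
  assumes D0: "D 0 = fps_X * (D 1 + D 0)"
    and DSuc: "\<And>a. D (Suc a) = fps_X * (D (Suc (Suc a)) + D (Suc a) + D a)"
  shows "D a = 0"
proof -
  have "D a $ n = 0" for n
  proof (induction n arbitrary: a)
    case 0
    have "D b $ 0 = 0" if "D b = fps_X * F" for b F
      unfolding that by simp
    then show ?case
      using D0 DSuc by (cases a) blast+
  next
    case (Suc n)
    have "D b $ Suc n = F $ n" if "D b = fps_X * F" for b F
      unfolding that by simp
    note * = this[OF D0] this[OF DSuc]
    show ?case
    proof (cases a)
      case 0
      then show ?thesis by (simp only: * fps_add_nth Suc.IH add_0)
    next
      case (Suc b)
      then show ?thesis by (simp only: * fps_add_nth Suc.IH add_0)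
    qed
  qed
  then show ?thesis
    by (simp add: fps_eq_iff)
qed

text \<open>
  Both sides, as functions of the height, solve the same recursion. This replaces the
  decomposition of a path at its first visit to the axis.
\<close>

lemma descents_gf_Suc_eq:
  "descents_gf f (Suc h) = fps_X * descents_gf True h * descents_gf f 0"
proof -
  define D where "D = (\<lambda>h. descents_gf f (Suc h) - fps_X * descents_gf True h * descents_gf f 0)"
  have "D h = 0"
  proof (rule fps_recursion_unique)
    \<comment> \<open>The summand 1, coming from the empty path, cancels the term
      \<open>descents_gf f 0\<close> of the recursion at height 1. What remains is the boundary
      equation for \<open>D\<close>.\<close>
    have "D 0 = fps_X * (descents_gf f (Suc (Suc 0)) + descents_gf f (Suc 0) + descents_gf f 0)
      - fps_X * (1 + fps_X * (descents_gf True 1 + descents_gf True 0)) * descents_gf f 0"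
      unfolding D_def using descents_gf_Suc[of f 0] descents_gf_0 by simp
    also have "\<dots> = fps_X * (D 1 + D 0)"
      by (simp add: D_def algebra_simps)
    finally show "D 0 = fps_X * (D 1 + D 0)" .
  next
    fix a
    have "D (Suc a) =
      fps_X * (descents_gf f (Suc (Suc (Suc a))) + descents_gf f (Suc (Suc a)) + descents_gf f (Suc a))
      - fps_X * (fps_X * (descents_gf True (Suc (Suc a)) + descents_gf True (Suc a)
          + descents_gf True a)) * descents_gf f 0"
      unfolding D_def using descents_gf_Suc[of f "Suc a"] descents_gf_Suc[of True a] by simp
    also have "\<dots> = fps_X * (D (Suc (Suc a)) + D (Suc a) + D a)"
      by (simp add: D_def algebra_simps)
    finally show "D (Suc a) = fps_X * (D (Suc (Suc a)) + D (Suc a) + D a)" .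
  qed
  then show ?thesis
    by (simp add: D_def)
qed

text \<open>One use of \<open>descents_gf_Suc_eq\<close> with the flag \<open>f\<close> reduces the
  claim to the flag \<open>True\<close>, where iteration yields one Motzkin factor and one down step
  \<open>fps_X\<close> per unit of height.\<close>

lemma descents_gf_eq:
  "descents_gf f h = fps_X ^ h * (descents_gf True 0 ^ h * descents_gf f 0)"
proof -
  have *: "descents_gf True h = fps_X ^ h * descents_gf True 0 ^ Suc h" for h
    by (induction h) (simp_all add: descents_gf_Suc_eq algebra_simps)
  show ?thesis
  proof (cases h)
    case (Suc i)
    then show ?thesis
      by (simp add: descents_gf_Suc_eq *[of i] algebra_simps)
  qed simp
qed

section \<open>Motzkin and Riordan paths as words of vertical steps\<close>

lemma vertex_map_Pair:
  assumes "i \<le> length w"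
  shows "vertex (map (Pair 1) w) i = (int i, sum_list (take i w))"
proof -
  have "sum_list (map (Pair 1) v) = (int (length v), sum_list v)" for v :: "int list"
    by (induction v) (auto simp: zero_prod_def)
  then show ?thesis
    using assms by (simp add: vertex_def take_map)
qed

text \<open>All steps have first coordinate 1, so the second coordinates determine the path, and the
  abscissa of its endpoint is its length.\<close>

lemma motzkin_paths_eq: "motzkin_paths n = map (Pair 1) ` descents True 0 n"
proof (intro equalityI subsetI)
  fix w :: "(int \<times> int) list"
  assume w: "w \<in> motzkin_paths n"
  define v where "v = map snd w"
  have wv: "w = map (Pair 1) v"
    using w by (auto simp: v_def motzkin_paths_def intro!: map_idI[symmetric])
  have "\<forall>i\<le>length v. 0 \<le> sum_list (take i v)" "int (length v) = int n" "sum_list v = 0"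
    using w vertex_map_Pair[of _ v] by (auto simp: wv motzkin_paths_def)
  moreover have "set v \<subseteq> {-1, 0, 1}"
    using w by (auto simp: wv motzkin_paths_def)
  ultimately show "w \<in> map (Pair 1) ` descents True 0 n"
    by (auto simp: wv descents_def)
next
  fix w :: "(int \<times> int) list"
  assume "w \<in> map (Pair 1) ` descents True 0 n"
  then show "w \<in> motzkin_paths n"
    by (auto simp: descents_def motzkin_paths_def vertex_map_Pair)
qed

lemma riordan_paths_eq: "riordan_paths n = map (Pair 1) ` descents False 0 n"
proof -
  have "descents False 0 n =
    {v \<in> descents True 0 n. \<not> (\<exists>i<length v. v ! i = 0 \<and> sum_list (take i v) = 0)}"
    by (auto simp: descents_def)
  then show ?thesis
    unfolding riordan_paths_def motzkin_paths_eq
    by (auto simp: vertex_map_Pair image_iff)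
qed

lemma GF_motzkin_number: "GF motzkin_number = descents_gf True 0"
  by (simp add: GF_def descents_gf_def motzkin_number_def motzkin_paths_eq card_image inj_on_def)

lemma GF_riordan_number: "GF riordan_number = descents_gf False 0"
  by (simp add: GF_def descents_gf_def riordan_number_def riordan_paths_eq card_image inj_on_def)

section \<open>Critical monomials as paths\<close>

lemma lookup_sum_single:
  assumes "finite A"
  shows "Poly_Mapping.lookup (\<Sum>i\<in>A. Poly_Mapping.single i (f i)) j = (if j \<in> A then f j else 0)"
  using assms by (simp add: lookup_sum lookup_single when_def)

lemma mon_deg_mon_upto: "mon_deg (mon_upto j s) = (\<Sum>i=1..j. Poly_Mapping.lookup s i)"
proof -
  have l: "Poly_Mapping.lookup (mon_upto j s) i =
      (if i \<in> {1..j} then Poly_Mapping.lookup s i else 0)" for i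
    by (simp only: mon_upto_def lookup_sum_single finite_atLeastAtMost)
  have "mon_deg (mon_upto j s) = (\<Sum>i=1..j. Poly_Mapping.lookup (mon_upto j s) i)"
    unfolding mon_deg_def
    by (rule sum.mono_neutral_left) (auto simp: l in_keys_iff split: if_splits)
  then show ?thesis
    by (simp add: l)
qed

lemma mon_dvd_iff: "mon_dvd t s \<longleftrightarrow> (\<forall>i. Poly_Mapping.lookup t i \<le> Poly_Mapping.lookup s i)"
proof
  assume "\<forall>i. Poly_Mapping.lookup t i \<le> Poly_Mapping.lookup s i"
  then have "s = t + (s - t)"
    by (intro poly_mapping_eqI) (simp add: lookup_add lookup_minus)
  then show "mon_dvd t s"
    unfolding mon_dvd_def by blast
qed (auto simp: mon_dvd_def lookup_add)

lemma mon_dvd_var: "mon_dvd (var j) s \<longleftrightarrow> 1 \<le> Poly_Mapping.lookup s j"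
  by (auto simp: mon_dvd_iff var_def lookup_single when_def)

lemma monomials_in_iff:
  "s \<in> monomials_in N \<longleftrightarrow> (\<forall>i. i \<notin> {1..N} \<longrightarrow> Poly_Mapping.lookup s i = 0)"
  by (auto simp: monomials_in_def in_keys_iff)

text \<open>By parity, \<open>k = 2 p + c\<close> forces the exponent of \<open>x\<^sub>j\<close> to be \<open>c\<close>.\<close>

lemma Crit_bar_iff:
  assumes k: "k = 2 * p + c" and c: "c \<in> {1, 2}" and j: "1 \<le> j" "j \<le> N"
  shows "s \<in> Crit_bar N (\<lambda>_. 3) k j \<longleftrightarrow>
    s \<in> monomials_in N \<and> m_free N (\<lambda>_. 3) s \<and> Poly_Mapping.lookup s j = c \<and>
    (\<Sum>i=1..<j. Poly_Mapping.lookup s i) = p + (j - 1)"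
proof -
  obtain j' where j': "j = Suc j'" using j by (cases j) auto
  have sum: "(\<Sum>i=1..j. Poly_Mapping.lookup s i) =
      (\<Sum>i=1..<j. Poly_Mapping.lookup s i) + Poly_Mapping.lookup s j"
    by (simp add: j' atLeastLessThanSuc_atLeastAtMost)
  \<comment> \<open>Here \<open>x\<close> is the exponent at \<open>j\<close> and \<open>y\<close>
    the sum of the earlier ones. The equation amounts to
    \<open>x = c + 2 * (p + (j - 1) - y)\<close> over the integers, so \<open>x\<close> and
    \<open>c\<close> have the same parity; both lie in {1, 2}, hence they agree.\<close>
  have "1 \<le> x \<and> int x = 2 * int (y + x) - int (2 * p + c) - (\<Sum>i=1..<j. int 3) + (int j - 1) \<longleftrightarrow>
      x = c \<and> y = p + (j - 1)" if "x < 3" for x y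
  proof -
    have "x = 0 \<or> x = 1 \<or> x = 2" "c = 1 \<or> c = 2"
      using that c by auto
    moreover have "(\<Sum>i=1..<j. int 3) = 3 * int j'" "int j - 1 = int j'" "j - 1 = j'"
      by (simp_all add: j')
    ultimately show ?thesis
      by presburger
  qed
  moreover have "Poly_Mapping.lookup s j < 3" if "m_free N (\<lambda>_. 3) s"
    using that j by (auto simp: m_free_def)
  ultimately show ?thesis
    unfolding Crit_bar_def mon_deg_mon_upto mon_dvd_var k mem_Collect_eq sum by blast
qed

text \<open>Greedy choice: each entry takes as much of \<open>b\<close> as \<open>s\<close> permits.
  This serves to trim a monomial to a divisor with prescribed exponent sum.\<close>

lemma exists_le_sum_eq:
  fixes s :: "'a \<Rightarrow> nat"
  assumes "finite A" "b \<le> sum s A"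
  shows "\<exists>t. (\<forall>i. t i \<le> s i) \<and> sum t A = b"
  using assms
proof (induction A arbitrary: b rule: finite_induct)
  case empty
  then show ?case by (auto intro: exI[of _ "\<lambda>_. 0"])
next
  case (insert x A)
  have "b - min b (s x) \<le> sum s A"
    using insert by auto
  then obtain t where t: "\<forall>i. t i \<le> s i" "sum t A = b - min b (s x)"
    using insert.IH by blast
  have "sum (t(x := min b (s x))) A = sum t A"
    using insert.hyps by (intro sum.cong) auto
  then show ?case
    using t insert.hyps by (intro exI[of _ "t(x := min b (s x))"]) auto
qed

text \<open>Passing to multiples relaxes the two equations of \<open>Crit_bar_iff\<close> to
  inequalities. Conversely, exponents that are too large can be lowered until equality
  holds.\<close>

lemma Crit_bar_dvd_iff:
  assumes k: "k = 2 * p + c" and c: "c \<in> {1, 2}" and j: "1 \<le> j" "j \<le> N"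
    and s: "m_free N (\<lambda>_. 3) s"
  shows "(\<exists>t\<in>Crit_bar N (\<lambda>_. 3) k j. mon_dvd t s) \<longleftrightarrow>
    c \<le> Poly_Mapping.lookup s j \<and> p + (j - 1) \<le> (\<Sum>i=1..<j. Poly_Mapping.lookup s i)"
proof
  assume "\<exists>t\<in>Crit_bar N (\<lambda>_. 3) k j. mon_dvd t s"
  then obtain t where t: "t \<in> Crit_bar N (\<lambda>_. 3) k j"
      "\<And>i. Poly_Mapping.lookup t i \<le> Poly_Mapping.lookup s i"
    by (auto simp: mon_dvd_iff)
  have "(\<Sum>i=1..<j. Poly_Mapping.lookup t i) \<le> (\<Sum>i=1..<j. Poly_Mapping.lookup s i)"
    by (intro sum_mono t)
  then show "c \<le> Poly_Mapping.lookup s j \<and> p + (j - 1) \<le> (\<Sum>i=1..<j. Poly_Mapping.lookup s i)"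
    using t(1) t(2)[of j] unfolding Crit_bar_iff[OF k c j] by simp
next
  assume *: "c \<le> Poly_Mapping.lookup s j \<and> p + (j - 1) \<le> (\<Sum>i=1..<j. Poly_Mapping.lookup s i)"
  then obtain u where u: "\<And>i. u i \<le> Poly_Mapping.lookup s i" "(\<Sum>i=1..<j. u i) = p + (j - 1)"
    using exists_le_sum_eq[of "{1..<j}" "p + (j - 1)" "Poly_Mapping.lookup s"] by auto
  define t where "t = (\<Sum>i=1..j. Poly_Mapping.single i ((u(j := c)) i))"
  have lt: "Poly_Mapping.lookup t i = (if i \<in> {1..j} then (u(j := c)) i else 0)" for i
    unfolding t_def by (rule lookup_sum_single) simp
  have le: "Poly_Mapping.lookup t i \<le> Poly_Mapping.lookup s i" for i
    using u(1)[of i] * by (auto simp: lt)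
  have "(\<Sum>i=1..<j. Poly_Mapping.lookup t i) = (\<Sum>i=1..<j. u i)"
    by (intro sum.cong) (auto simp: lt)
  moreover have "m_free N (\<lambda>_. 3) t"
    using s le by (auto simp: m_free_def intro: le_less_trans)
  ultimately have "t \<in> Crit_bar N (\<lambda>_. 3) k j"
    unfolding Crit_bar_iff[OF k c j] using j u by (auto simp: lt monomials_in_iff)
  then show "\<exists>t\<in>Crit_bar N (\<lambda>_. 3) k j. mon_dvd t s"
    using le by (auto simp: mon_dvd_iff)
qed

text \<open>Exponents 0, 1, 2 become up, flat and down steps. Position \<open>i\<close> belongs to
  the variable of index \<open>Suc i\<close>; the variable of index \<open>Suc n\<close> is left
  out, as its exponent will be the constant \<open>c\<close>.\<close>

definition exps_word :: "nat \<Rightarrow> monomial \<Rightarrow> int list" where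
  "exps_word n s = map (\<lambda>i. 1 - int (Poly_Mapping.lookup s (Suc i))) [0..<n]"

lemma sum_list_take_exps_word:
  "i \<le> n \<Longrightarrow> sum_list (take i (exps_word n s)) =
    int i - int (\<Sum>l=1..<Suc i. Poly_Mapping.lookup s l)"
  by (induction i) (auto simp: take_Suc_conv_app_nth exps_word_def)

text \<open>At height at most 0 the down step is forbidden, and for \<open>c = 1\<close> the flat
  step too. To get below the axis, a path starting at \<open>p\<close> would first need a down step
  from height 0.\<close>

lemma descents_iff:
  assumes c: "c \<in> {1, 2}" and p: "p \<ge> 0" and w: "length w = n" "set w \<subseteq> {-1, 0, 1}"
  shows "w \<in> descents (c = 2) p n \<longleftrightarrow> p + sum_list w = 0 \<and>
    (\<forall>i<n. \<not> (c \<le> 1 - w ! i \<and> p + sum_list (take i w) \<le> 0))" (is "?L \<longleftrightarrow> ?R")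
proof
  have step: "sum_list (take (Suc i) w) = sum_list (take i w) + w ! i" if "i < n" for i
    using that w by (simp add: take_Suc_conv_app_nth)
  have nth: "w ! i \<in> {-1, 0, 1}" if "i < n" for i
    using that w nth_mem by blast
  show ?R if L: ?L
  proof -
    have "\<not> (c \<le> 1 - w ! i \<and> p + sum_list (take i w) \<le> 0)" if "i < n" for i
    proof -
      have "0 \<le> p + sum_list (take i w)" "0 \<le> p + sum_list (take (Suc i) w)"
        using L \<open>i < n\<close> by (auto simp: descents_def simp del: take_Suc)
      moreover have "c = 2 \<or> \<not> (w ! i = 0 \<and> p + sum_list (take i w) = 0)"
        using L \<open>i < n\<close> by (auto simp: descents_def)
      ultimately show ?thesis
        using step[OF that] c by auto
    qed
    then show ?thesis
      using L by (simp add: descents_def)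
  qed
  show ?L if R: ?R
  proof -
    have "0 \<le> p + sum_list (take i w)" if "i \<le> n" for i
      using that
    proof (induction i)
      case (Suc i)
      then show ?case
        using step[of i] nth[of i] R[THEN conjunct2, rule_format, of i] c by auto
    qed (use p in simp)
    moreover have "\<not> (w ! i = 0 \<and> p + sum_list (take i w) = 0)" if "i < n" "c \<noteq> 2" for i
      using that R c by auto
    ultimately show ?thesis
      using R w by (auto simp: descents_def)
  qed
qed

text \<open>The height after \<open>i\<close> steps is \<open>p + i\<close> minus the sum of the
  first \<open>i\<close> exponents. Hence a critical divisor for the index \<open>Suc i\<close>
  exists exactly if step \<open>i\<close> is forbidden in the sense of \<open>descents_iff\<close>,
  and the sum equation for \<open>Suc n\<close> says that the path ends on the axis.\<close>

lemma Crit_iff: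
  fixes c p n :: nat
  assumes k: "k = 2 * p + c" and c: "c \<in> {1, 2}"
  shows "s \<in> Crit (Suc n) (\<lambda>_. 3) k (Suc n) \<longleftrightarrow>
    s \<in> monomials_in (Suc n) \<and> m_free (Suc n) (\<lambda>_. 3) s \<and>
    Poly_Mapping.lookup s (Suc n) = c \<and> exps_word n s \<in> descents (c = 2) (int p) n"
    (is "?L \<longleftrightarrow> ?R")
proof (cases "m_free (Suc n) (\<lambda>_. 3) s")
  case True
  let ?S = "\<lambda>i. \<Sum>l=1..<Suc i. Poly_Mapping.lookup s l"
  have len: "length (exps_word n s) = n"
    by (simp add: exps_word_def)
  have "1 - int (Poly_Mapping.lookup s (Suc i)) \<in> {-1, 0, 1}" if "i < n" for i
  proof -
    have "Poly_Mapping.lookup s (Suc i) < 3"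
      using True that by (auto simp: m_free_def)
    then show ?thesis by auto
  qed
  then have set: "set (exps_word n s) \<subseteq> {-1, 0, 1}"
    by (simp add: exps_word_def image_subset_iff del: insert_iff)
  have "exps_word n s \<in> descents (int c = 2) (int p) n \<longleftrightarrow>
    int p + sum_list (exps_word n s) = 0 \<and> (\<forall>i<n. \<not> (int c \<le> 1 - exps_word n s ! i \<and>
      int p + sum_list (take i (exps_word n s)) \<le> 0))"
    using c by (intro descents_iff len set) auto
  also have "int p + sum_list (exps_word n s) = 0 \<longleftrightarrow> ?S n = p + n"
    using sum_list_take_exps_word[of n n s] len by (simp del: sum.op_ivl_Suc of_nat_sum) linarith
  also have "(\<forall>i<n. \<not> (int c \<le> 1 - exps_word n s ! i \<and>
      int p + sum_list (take i (exps_word n s)) \<le> 0)) \<longleftrightarrow>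
    (\<forall>i<n. \<not> (c \<le> Poly_Mapping.lookup s (Suc i) \<and> p + i \<le> ?S i))"
  proof (intro all_cong)
    fix i
    assume "i < n"
    then have "exps_word n s ! i = 1 - int (Poly_Mapping.lookup s (Suc i))"
      by (simp add: exps_word_def)
    then show "\<not> (int c \<le> 1 - exps_word n s ! i \<and> int p + sum_list (take i (exps_word n s)) \<le> 0) \<longleftrightarrow>
      \<not> (c \<le> Poly_Mapping.lookup s (Suc i) \<and> p + i \<le> ?S i)"
      using sum_list_take_exps_word[of i n s] \<open>i < n\<close> by linarith
  qed
  also have "\<dots> \<longleftrightarrow> (\<forall>l\<in>{1..<Suc n}. \<forall>t\<in>Crit_bar (Suc n) (\<lambda>_. 3) k l. \<not> mon_dvd t s)"
  proof -
    have "(\<forall>t\<in>Crit_bar (Suc n) (\<lambda>_. 3) k (Suc i). \<not> mon_dvd t s) \<longleftrightarrow>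
      \<not> (c \<le> Poly_Mapping.lookup s (Suc i) \<and> p + i \<le> ?S i)" if "i < n" for i
      using Crit_bar_dvd_iff[OF k c _ _ True, of "Suc i"] that by auto
    moreover have "{1..<Suc n} = Suc ` {..<n}"
      by (simp add: lessThan_atLeast0)
    ultimately show ?thesis
      by (simp only: ball_simps lessThan_iff Ball_def[of "{..<n}"] cong: imp_cong)
  qed
  finally show ?thesis
    using True Crit_bar_iff[OF k c, of "Suc n" "Suc n" s]
    by (auto simp: Crit_def simp del: sum.op_ivl_Suc)
qed (simp add: Crit_def Crit_bar_def)

lemma card_Crit:
  fixes c p n :: nat
  assumes k: "k = 2 * p + c" and c: "c \<in> {1, 2}"
  shows "card (Crit (Suc n) (\<lambda>_. 3) k (Suc n)) = card (descents (c = 2) (int p) n)"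
proof (rule bij_betw_same_card, rule bij_betw_imageI)
  let ?C = "Crit (Suc n) (\<lambda>_. 3) k (Suc n)"
  show "inj_on (exps_word n) ?C"
  proof (rule inj_onI, rule poly_mapping_eqI)
    fix s t i
    assume s: "s \<in> ?C" and t: "t \<in> ?C" and eq: "exps_word n s = exps_word n t"
    consider "i \<notin> {1..Suc n}" | "i = Suc n" | l where "i = Suc l" "l < n"
      by (cases i) force+
    then show "Poly_Mapping.lookup s i = Poly_Mapping.lookup t i"
    proof cases
      case 3
      then show ?thesis using eq by (simp add: exps_word_def)
    qed (use s t in \<open>auto simp: Crit_iff[OF k c] monomials_in_iff\<close>)
  qed
  show "exps_word n ` ?C = descents (c = 2) (int p) n"
  proof (intro equalityI subsetI)
    fix w
    assume w: "w \<in> descents (c = 2) (int p) n"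
    \<comment> \<open>This inverts the encoding; \<open>nat\<close> loses nothing, because
      \<open>1 - w ! (i - 1)\<close> is 0, 1 or 2 for \<open>i\<close> in {1..n}.\<close>
    define u where "u = (\<lambda>i. if i = Suc n then c else nat (1 - w ! (i - 1)))"
    define s where "s = (\<Sum>i=1..Suc n. Poly_Mapping.single i (u i))"
    have ls: "Poly_Mapping.lookup s i = (if i \<in> {1..Suc n} then u i else 0)" for i
      unfolding s_def by (rule lookup_sum_single) simp
    have nth: "w ! i \<in> {-1, 0, 1}" if "i < n" for i
      using w that nth_mem[of i w] unfolding descents_def by blast
    have "exps_word n s = w"
      using w nth by (intro nth_equalityI) (force simp: exps_word_def descents_def ls u_def)+
    moreover have "Poly_Mapping.lookup s i < 3" if "i \<in> {1..Suc n}" for i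
    proof (cases "i = Suc n")
      case False
      then have "w ! (i - 1) \<in> {-1, 0, 1}"
        using that by (intro nth) auto
      then show ?thesis
        using False that by (auto simp: ls u_def)
    qed (use c in \<open>auto simp: ls u_def\<close>)
    ultimately have "s \<in> ?C"
      using w by (auto simp: Crit_iff[OF k c] ls monomials_in_iff m_free_def u_def)
    then show "w \<in> exps_word n ` ?C"
      using \<open>exps_word n s = w\<close> by blast
  qed (auto simp: Crit_iff[OF k c])
qed

section \<open>The generating function of the critical monomials\<close>

lemma GF_g3:
  fixes c p :: nat
  assumes k: "k = 2 * p + c" and c: "c \<in> {1, 2}"
  shows "GF (g3 k) = descents_gf True 0 ^ p * descents_gf (c = 2) 0"
proof (rule fps_ext)
  fix n
  \<comment> \<open>Half of \<open>k\<close> rounds up to \<open>p + 1\<close> for both values of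
    \<open>c\<close>, so there are \<open>Suc (n + p)\<close> variables and the paths have length
    \<open>n + p\<close>.\<close>
  have "delta k = Suc p"
    using c unfolding delta_def k by (auto simp: ceiling_eq_iff nat_eq_iff)
  then have "GF (g3 k) $ n = int (card (descents (c = 2) (int p) (n + p)))"
    by (simp add: GF_def g3_def card_Crit[OF k c])
  also have "\<dots> = descents_gf (c = 2) p $ (n + p)"
    by (simp add: descents_gf_def)
  \<comment> \<open>The factor \<open>fps_X ^ p\<close> of \<open>descents_gf_eq\<close> shifts the
    index from \<open>n + p\<close> to \<open>n\<close>.\<close>
  also have "\<dots> = (descents_gf True 0 ^ p * descents_gf (c = 2) 0) $ n"
    by (subst descents_gf_eq) (simp add: fps_X_power_mult_nth)
  finally show "GF (g3 k) $ n = (descents_gf True 0 ^ p * descents_gf (c = 2) 0) $ n" .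
qed

theorem theorem5p5:
  fixes k q r :: nat
  assumes "k \<ge> 1"
    and "k = 2 * q + r"
    and "r \<in> {0, 1}"
  shows "GF (g3 k) = GF motzkin_number ^ q * GF riordan_number ^ r"
proof (cases "r = 0")
  case True
  \<comment> \<open>An even \<open>k = 2 * q\<close> is written with \<open>c = 2\<close> and
    \<open>p = q - 1\<close>; the final factor is then a Motzkin series and restores the exponent
    \<open>q\<close>.\<close>
  then obtain p where "q = Suc p"
    using assms by (cases q) auto
  then show ?thesis
    using GF_g3[of k p 2] assms True by (simp add: GF_motzkin_number)
next
  case False
  then show ?thesis
    using GF_g3[of k q 1] assms by (simp add: GF_motzkin_number GF_riordan_number)
qed

end
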